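(* Let $L\colon A\to\mathbb{R}$ be a linear functional with $L(1)=1$ that is represented by a Radon measure $\nu_L$ on $X(A)$ with compact support $K$, and let $d\in\mathbb{N}$. Then $$\nu_L(\{\alpha\})=\max\big\{\lambda\in[0,1]: \sqrt[2^d]{\lambda}\;p_L(a)\le p_d(a)\text{ for all }a\in[\alpha]_K\big\}\qquad\text{for all }\alpha\in K.$$
   Context: $A$ is a unital commutative $\mathbb{R}$-algebra whose character space $X(A)$ (the set of all (unital) $\mathbb{R}$-algebra homomorphisms $A\to\mathbb{R}$) is non-empty; $X(A)$ carries the weakest topology making all $\hat a\colon X(A)\to\mathbb{R}$, $\hat a(\alpha)=\alpha(a)$, $a\in A$, continuous. A Radon measure on $X(A)$ is a non-negative Borel measure that is locally finite and inner regular w.r.t. compact sets; its support is the smallest closed set with complement of measure zero. $L$ is represented by $\nu_L$ if $L(a)=\int\hat a\,\mathrm{d}\nu_L$ for all $a\in A$. Notation: $\mathbb{N}=\{1,2,\dots\}$; $p_d(a):=\sqrt[2^d]{L(a^{2^d})}$ for $d\in\mathbb{N}$, $a\in A$; $p_L(a):=\sup_{n\in\mathbb{N}}\sqrt[2n]{L(a^{2n})}$ (finite here). $\|a\|_K:=\max_{\beta\in K}|\beta(a)|$ and, for $\alpha\in K$, $[\alpha]_K:=\{a\in A:\|a\|_K=|\alpha(a)|\}$. *)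

theory Defs
  imports "HOL-Analysis.Analysis"
begin

definition character_space :: "('a::{real_algebra_1,comm_ring_1} \<Rightarrow> real) set" where
  "character_space = {\<alpha>. linear \<alpha> \<and> (\<forall>a b. \<alpha> (a * b) = \<alpha> a * \<alpha> b) \<and> \<alpha> 1 = 1}"

definition character_topology :: "('a::{real_algebra_1,comm_ring_1} \<Rightarrow> real) topology" where
  "character_topology =
     topology_generated_by {{\<alpha> \<in> character_space. \<alpha> a \<in> U} | a U. open U}"

lemma topspace_character_topology [simp]: "topspace character_topology = character_space"
  unfolding character_topology_def by (auto intro!: exI[of _ UNIV])

lemma continuous_map_character_topology_eval:
  "continuous_map character_topology euclideanreal (\<lambda>\<alpha>. \<alpha> a)"
proof -
  have "openin character_topology {\<alpha> \<in> character_space. \<alpha> a \<in> U}" if "open U" for U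
    unfolding character_topology_def using that by (intro topology_generated_by_Basis) blast
  then show ?thesis by (simp add: continuous_map_def)
qed

lemma character_topology_weakest:
  assumes "topspace T = character_space"
    and "\<And>a. continuous_map T euclideanreal (\<lambda>\<alpha>. \<alpha> a)"
    and "openin character_topology V"
  shows "openin T V"
proof -
  have "generate_topology_on {{\<alpha> \<in> character_space. \<alpha> a \<in> U} | a U. open U} V"
    using assms(3) by (simp add: character_topology_def openin_topology_generated_by_iff)
  then show ?thesis
  proof induction
    case (Basis S)
    then show ?case using assms(1,2) by (auto simp: continuous_map_def)
  qed auto
qed

definition radon_measure :: "'x topology \<Rightarrow> 'x measure \<Rightarrow> bool" where
  "radon_measure T \<nu> \<longleftrightarrow>
     space \<nu> = topspace T \<and>
     sets \<nu> = sigma_sets (topspace T) {U. openin T U} \<and>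
     (\<forall>x\<in>topspace T. \<exists>U. openin T U \<and> x \<in> U \<and> emeasure \<nu> U < \<infinity>) \<and>
     (\<forall>B\<in>sets \<nu>. emeasure \<nu> B = (SUP C\<in>{C. compactin T C \<and> C \<subseteq> B}. emeasure \<nu> C))"

definition is_support :: "'x topology \<Rightarrow> 'x measure \<Rightarrow> 'x set \<Rightarrow> bool" where
  "is_support T \<nu> K \<longleftrightarrow>
     closedin T K \<and> emeasure \<nu> (topspace T - K) = 0 \<and>
     (\<forall>C. closedin T C \<and> emeasure \<nu> (topspace T - C) = 0 \<longrightarrow> K \<subseteq> C)"

text \<open>Integrability of every evaluation map is part of being represented, because the
  library integral of a non-integrable function is \<open>0\<close>.\<close>

definition represented_by ::
  "('a::{real_algebra_1,comm_ring_1} \<Rightarrow> real) \<Rightarrow> ('a \<Rightarrow> real) measure \<Rightarrow> bool" where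
  "represented_by L \<nu> \<longleftrightarrow> (\<forall>a. has_bochner_integral \<nu> (\<lambda>\<alpha>. \<alpha> a) (L a))"

definition p_pow :: "('a::{real_algebra_1,comm_ring_1} \<Rightarrow> real) \<Rightarrow> nat \<Rightarrow> 'a \<Rightarrow> real" where
  "p_pow L d a = root (2 ^ d) (L (a ^ (2 ^ d)))"

definition p_sup :: "('a::{real_algebra_1,comm_ring_1} \<Rightarrow> real) \<Rightarrow> 'a \<Rightarrow> real" where
  "p_sup L a = (SUP n\<in>{1..}. root (2 * n) (L (a ^ (2 * n))))"

text \<open>The maximum exists when \<open>K\<close> is non-empty and compact; \<^const>\<open>Max\<close> is unsuitable
  because it is only meaningful for finite sets.\<close>

definition norm_on :: "('a \<Rightarrow> real) set \<Rightarrow> 'a \<Rightarrow> real" where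
  "norm_on K a = (GREATEST r. r \<in> (\<lambda>\<beta>. \<bar>\<beta> a\<bar>) ` K)"

definition peak_set :: "('a \<Rightarrow> real) set \<Rightarrow> ('a \<Rightarrow> real) \<Rightarrow> 'a set" where
  "peak_set K \<alpha> = {a. norm_on K a = \<bar>\<alpha> a\<bar>}"

definition is_maximum :: "real set \<Rightarrow> real \<Rightarrow> bool" where
  "is_maximum S m \<longleftrightarrow> m \<in> S \<and> (\<forall>s\<in>S. s \<le> m)"

end

theory Submission
  imports Defs "HOL-Probability.Probability_Measure"
begin

text \<open>Since \<open>L (a ^ (2 * n))\<close> is an even moment of the evaluation at \<open>a\<close>, the supremum \<open>p_sup L a\<close>
  is the maximal absolute value of that evaluation on the support, so on the peak set of \<open>\<alpha>\<close> it equals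
  \<open>\<bar>\<alpha> a\<bar>\<close>. The mass of \<open>\<alpha>\<close> is then admissible by Markov's inequality. For its maximality, inner
  regularity provides a compact \<open>C\<close> avoiding \<open>\<alpha>\<close> that carries almost all the remaining mass. A finite
  sum \<open>c\<close> of squares vanishes at \<open>\<alpha>\<close> and is positive on \<open>C\<close>; high powers of \<open>1 - c / M\<close> peak at
  \<open>\<alpha>\<close> and are uniformly small on \<open>C\<close>, and testing with them yields the upper bound.\<close>

section \<open>Characters\<close>

lemma character_linear: "\<beta> \<in> character_space \<Longrightarrow> linear \<beta>"
  and character_mult: "\<beta> \<in> character_space \<Longrightarrow> \<beta> (a * b) = \<beta> a * \<beta> b"
  and character_one: "\<beta> \<in> character_space \<Longrightarrow> \<beta> 1 = 1"
  by (auto simp: character_space_def)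

lemma character_diff: "\<beta> \<in> character_space \<Longrightarrow> \<beta> (a - b) = \<beta> a - \<beta> b"
  and character_scaleR: "\<beta> \<in> character_space \<Longrightarrow> \<beta> (c *\<^sub>R a) = c * \<beta> a"
  and character_sum: "\<beta> \<in> character_space \<Longrightarrow> \<beta> (\<Sum>i\<in>I. f i) = (\<Sum>i\<in>I. \<beta> (f i))"
  using linear_diff[OF character_linear, of \<beta> a b] linear_scale[OF character_linear, of \<beta> c a]
    linear_sum[OF character_linear, of \<beta> f I]
  by auto

lemma character_power: "\<beta> \<in> character_space \<Longrightarrow> \<beta> (a ^ n) = \<beta> a ^ n"
  by (induction n) (auto simp: character_one character_mult)

lemma openin_character_topology_eval:
  assumes "open U"
  shows "openin character_topology {\<beta> \<in> character_space. \<beta> a \<in> U}"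
  using continuous_map_character_topology_eval[of a] assms by (auto simp: continuous_map_def)

text \<open>Distinct characters differ at some element, and disjoint open sets around the two values
  pull back along its evaluation. The use is that compact sets, in particular singletons, become
  closed and hence measurable.\<close>

lemma Hausdorff_space_character_topology:
  "Hausdorff_space (character_topology :: ('a::{real_algebra_1,comm_ring_1} \<Rightarrow> real) topology)"
  unfolding Hausdorff_space_def
proof (intro allI impI, elim conjE)
  fix x y :: "'a \<Rightarrow> real"
  assume xy: "x \<in> topspace character_topology" "y \<in> topspace character_topology" "x \<noteq> y"
  then obtain a where "x a \<noteq> y a" by auto
  from hausdorff[OF this] obtain S T
    where ST: "open S" "open T" "x a \<in> S" "y a \<in> T" "S \<inter> T = {}" by blast
  let ?U = "{\<beta> \<in> character_space. \<beta> a \<in> S}" and ?V = "{\<beta> \<in> character_space. \<beta> a \<in> T}"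
  have "openin character_topology ?U" "openin character_topology ?V"
    using ST by (simp_all add: openin_character_topology_eval)
  moreover have "x \<in> ?U" "y \<in> ?V" "disjnt ?U ?V" using xy ST by (auto simp: disjnt_def)
  ultimately show "\<exists>U V. openin character_topology U \<and> openin character_topology V \<and>
      x \<in> U \<and> y \<in> V \<and> disjnt U V"
    by blast
qed

lemma compact_eval_image:
  assumes "compactin character_topology K"
  shows "compact ((\<lambda>\<beta>. \<bar>\<beta> a\<bar>) ` K)"
proof -
  have "compact ((\<lambda>\<beta>. \<beta> a) ` K)"
    using image_compactin[OF assms continuous_map_character_topology_eval[of a]] by simp
  then have "compact (abs ` (\<lambda>\<beta>. \<beta> a) ` K)"
    by (rule compact_continuous_image[rotated]) (intro continuous_intros)
  then show ?thesis by (simp add: image_image)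
qed

text \<open>Compactness makes the maximum behind \<open>norm_on\<close> attained, so the
  \<open>GREATEST\<close> has its intended value. Later arguments use only this pointwise
  form.\<close>

lemma mem_peak_set_iff:
  assumes "compactin character_topology K" and "\<alpha> \<in> K"
  shows "a \<in> peak_set K \<alpha> \<longleftrightarrow> (\<forall>\<beta>\<in>K. \<bar>\<beta> a\<bar> \<le> \<bar>\<alpha> a\<bar>)"
proof -
  have "(\<lambda>\<beta>. \<bar>\<beta> a\<bar>) ` K \<noteq> {}" using assms(2) by auto
  then obtain \<gamma> where \<gamma>: "\<gamma> \<in> K" "\<forall>\<beta>\<in>K. \<bar>\<beta> a\<bar> \<le> \<bar>\<gamma> a\<bar>"
    using compact_attains_sup[OF compact_eval_image[OF assms(1)], of a] by blast
  have "norm_on K a = \<bar>\<gamma> a\<bar>"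
    unfolding norm_on_def using \<gamma> by (intro Greatest_equality) auto
  then have "a \<in> peak_set K \<alpha> \<longleftrightarrow> \<bar>\<gamma> a\<bar> = \<bar>\<alpha> a\<bar>" by (simp add: peak_set_def)
  also have "\<dots> \<longleftrightarrow> (\<forall>\<beta>\<in>K. \<bar>\<beta> a\<bar> \<le> \<bar>\<alpha> a\<bar>)"
    using \<gamma> assms(2) antisym by metis
  finally show ?thesis .
qed

section \<open>Peaking elements\<close>

text \<open>Every \<beta> in \<open>C\<close> differs from \<alpha> at some \<open>b\<close>, so the
  square of \<open>b\<close> shifted by its value at \<alpha> is positive on a neighbourhood of
  \<beta>. Finitely many such neighbourhoods cover \<open>C\<close>, and adding squares causes no
  cancellation.\<close>

lemma exists_separating_sum_of_squares:
  fixes \<alpha> :: "'a::{real_algebra_1,comm_ring_1} \<Rightarrow> real"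
  assumes \<alpha>: "\<alpha> \<in> character_space" and C: "compactin character_topology C" and "\<alpha> \<notin> C"
  obtains c where "\<alpha> c = 0" "\<And>\<beta>. \<beta> \<in> character_space \<Longrightarrow> 0 \<le> \<beta> c" "\<And>\<beta>. \<beta> \<in> C \<Longrightarrow> 0 < \<beta> c"
proof -
  define q :: "'a \<Rightarrow> 'a" where "q b = (b - \<alpha> b *\<^sub>R 1)\<^sup>2" for b
  have q: "\<beta> (q b) = (\<beta> b - \<alpha> b)\<^sup>2" if "\<beta> \<in> character_space" for \<beta> b
    using that by (simp add: q_def character_power character_diff character_scaleR character_one)
  have CX: "C \<subseteq> character_space" using compactin_subset_topspace[OF C] by simp
  \<comment> \<open>\<open>W b\<close> is the set of characters on which \<open>q b\<close> does not
    vanish. Stating it through the open set \<open>- {\<alpha> b}\<close> shows that it is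
    open.\<close>
  define W where "W b = {\<beta> \<in> character_space. \<beta> b \<in> - {\<alpha> b}}" for b
  have "C \<subseteq> \<Union> (range W)"
  proof
    fix \<beta> assume "\<beta> \<in> C"
    with assms(3) have "\<beta> \<noteq> \<alpha>" by auto
    then obtain b where "\<beta> b \<noteq> \<alpha> b" by auto
    with \<open>\<beta> \<in> C\<close> CX show "\<beta> \<in> \<Union> (range W)" by (auto simp: W_def)
  qed
  moreover have "\<forall>U\<in>range W. openin character_topology U"
    by (auto simp: W_def intro!: openin_character_topology_eval simp del: Compl_iff)
  ultimately obtain \<F> where "finite \<F>" "\<F> \<subseteq> range W" "C \<subseteq> \<Union> \<F>"
    using C[unfolded compactin_def, THEN conjunct2, rule_format, of "range W"] by blast
  then obtain F where F: "finite F" "C \<subseteq> \<Union> (W ` F)"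
    using finite_subset_image[of \<F> W UNIV] by blast
  have sum: "\<beta> (\<Sum>b\<in>F. q b) = (\<Sum>b\<in>F. (\<beta> b - \<alpha> b)\<^sup>2)" if "\<beta> \<in> character_space" for \<beta>
    using that by (simp add: character_sum q)
  show thesis
  proof
    show "\<alpha> (\<Sum>b\<in>F. q b) = 0" using \<alpha> by (simp add: sum)
    show "0 \<le> \<beta> (\<Sum>b\<in>F. q b)" if "\<beta> \<in> character_space" for \<beta>
      using that by (simp add: sum sum_nonneg)
    show "0 < \<beta> (\<Sum>b\<in>F. q b)" if \<beta>: "\<beta> \<in> C" for \<beta>
    proof -
      obtain b where "b \<in> F" "\<beta> b \<noteq> \<alpha> b" using F(2) \<beta> by (auto simp: W_def)
      then have "0 < (\<Sum>b\<in>F. (\<beta> b - \<alpha> b)\<^sup>2)" using F(1) by (intro sum_pos2) auto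
      then show ?thesis using \<beta> CX by (auto simp: sum)
    qed
  qed
qed

text \<open>With \<open>c\<close> as in the preceding lemma and \<open>M\<close> a bound for it on
  \<open>K\<close>, the element \<open>b = 1 - c / M\<close> has values in [0,1] on
  \<open>K\<close>, equals 1 at \<alpha> and stays away from 1 on \<open>K \<inter> C\<close>. A
  high power of \<open>b\<close> is the required element.\<close>

lemma exists_peaking_element:
  fixes \<alpha> :: "'a::{real_algebra_1,comm_ring_1} \<Rightarrow> real"
  assumes K: "compactin character_topology K" and C: "compactin character_topology C"
    and \<alpha>: "\<alpha> \<in> K" "\<alpha> \<notin> C" and "0 < \<epsilon>"
  obtains a where "\<alpha> a = 1" "\<And>\<beta>. \<beta> \<in> K \<Longrightarrow> \<bar>\<beta> a\<bar> \<le> 1" "\<And>\<beta>. \<beta> \<in> K \<inter> C \<Longrightarrow> \<bar>\<beta> a\<bar> < \<epsilon>"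
proof -
  have KX: "K \<subseteq> character_space" using compactin_subset_topspace[OF K] by simp
  obtain c where c: "\<alpha> c = 0" "\<And>\<beta>. \<beta> \<in> character_space \<Longrightarrow> 0 \<le> \<beta> c" "\<And>\<beta>. \<beta> \<in> C \<Longrightarrow> 0 < \<beta> c"
    using exists_separating_sum_of_squares[of \<alpha> C] \<alpha> C KX by blast
  have "bounded ((\<lambda>\<beta>. \<bar>\<beta> c\<bar>) ` K)" by (rule compact_imp_bounded[OF compact_eval_image[OF K]])
  then obtain M where M: "0 < M" "\<And>\<beta>. \<beta> \<in> K \<Longrightarrow> \<bar>\<beta> c\<bar> \<le> M"
    by (auto simp: bounded_pos)
  obtain \<delta> where \<delta>: "0 < \<delta>" "\<And>\<beta>. \<beta> \<in> K \<inter> C \<Longrightarrow> \<delta> \<le> \<beta> c"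
  proof (cases "K \<inter> C = {}")
    case True
    then show ?thesis using that[of 1] by auto
  next
    case False
    have "compactin character_topology (K \<inter> C)"
      by (rule compact_Int_closedin[OF K compactin_imp_closedin[OF Hausdorff_space_character_topology C]])
    from compact_attains_inf[OF compact_eval_image[OF this, of c]] False
    obtain \<gamma> where \<gamma>: "\<gamma> \<in> K \<inter> C" "\<And>\<beta>. \<beta> \<in> K \<inter> C \<Longrightarrow> \<bar>\<gamma> c\<bar> \<le> \<bar>\<beta> c\<bar>" by blast
    show ?thesis
    proof
      show "0 < \<bar>\<gamma> c\<bar>" using c(3)[of \<gamma>] \<gamma>(1) by simp
      show "\<bar>\<gamma> c\<bar> \<le> \<beta> c" if "\<beta> \<in> K \<inter> C" for \<beta>
        using c(3)[of \<beta>] \<gamma>(2)[OF that] that by simp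
    qed
  qed
  define b where "b = 1 - (1 / M) *\<^sub>R c"
  have b: "\<beta> b = 1 - \<beta> c / M" if "\<beta> \<in> character_space" for \<beta>
    using that by (simp add: b_def character_diff character_scaleR character_one)
  have b01: "0 \<le> \<beta> b" "\<beta> b \<le> 1" if "\<beta> \<in> K" for \<beta>
    using that KX c(2)[of \<beta>] M(1) M(2)[of \<beta>] by (auto simp: b)
  \<comment> \<open>The maximum with 0 keeps the base nonnegative: \<delta> is arbitrary when
    \<open>K \<inter> C\<close> is empty, so \<open>1 - \<delta> / M\<close> may be
    negative.\<close>
  define r where "r = max 0 (1 - \<delta> / M)"
  have r: "0 \<le> r" "r < 1" using \<delta>(1) M(1) by (auto simp: r_def)
  have br: "\<beta> b \<le> r" if "\<beta> \<in> K \<inter> C" for \<beta>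
    using that KX \<delta>(2)[of \<beta>] M(1) by (auto simp: b r_def le_max_iff_disj divide_right_mono)
  obtain n where n: "r ^ n < \<epsilon>" using real_arch_pow_inv[OF \<open>0 < \<epsilon>\<close> r(2)] by blast
  have pow: "\<beta> (b ^ n) = \<beta> b ^ n" if "\<beta> \<in> K" for \<beta> using that KX by (auto simp: character_power)
  show thesis
  proof
    show "\<alpha> (b ^ n) = 1" using \<alpha>(1) KX by (auto simp: pow b c(1))
    show "\<bar>\<beta> (b ^ n)\<bar> \<le> 1" if "\<beta> \<in> K" for \<beta>
      using that b01[of \<beta>] by (simp add: pow power_le_one)
    show "\<bar>\<beta> (b ^ n)\<bar> < \<epsilon>" if "\<beta> \<in> K \<inter> C" for \<beta>
    proof -
      have "\<beta> b ^ n \<le> r ^ n" using that b01[of \<beta>] br[of \<beta>] by (intro power_mono) auto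
      then show ?thesis using n that b01[of \<beta>] by (simp add: pow)
    qed
  qed
qed

section \<open>Moments of the representing measure\<close>

locale represented_functional =
  fixes L :: "'a::{real_algebra_1,comm_ring_1} \<Rightarrow> real"
    and \<nu> :: "('a \<Rightarrow> real) measure"
    and K :: "('a \<Rightarrow> real) set"
  assumes L_one: "L 1 = 1"
    and radon: "radon_measure character_topology \<nu>"
    and represented: "represented_by L \<nu>"
    and support: "is_support character_topology \<nu> K"
    and compact_support: "compactin character_topology K"
begin

section \<open>Measurability, total mass and support\<close>

lemma space_eq: "space \<nu> = character_space"
  using radon by (simp add: radon_measure_def)

lemma openin_sets: "openin character_topology U \<Longrightarrow> U \<in> sets \<nu>"
  using radon by (auto simp: radon_measure_def)

lemma closedin_sets:
  assumes "closedin character_topology C"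
  shows "C \<in> sets \<nu>"
proof -
  have "space \<nu> - (character_space - C) \<in> sets \<nu>"
    using assms by (intro sets.compl_sets openin_sets) (simp add: closedin_def)
  moreover have "C \<subseteq> character_space" using closedin_subset[OF assms] by simp
  ultimately show ?thesis by (simp add: space_eq double_diff)
qed

lemma support_subset: "K \<subseteq> character_space"
  using compactin_subset_topspace[OF compact_support] by simp

text \<open>Multiplicativity turns the values of \<open>L\<close> at powers of \<open>a\<close> into
  moments of the evaluation at \<open>a\<close>. The two integrands need to agree only on the space
  of \<nu>, which consists of characters.\<close>

lemma has_bochner_integral_power: "has_bochner_integral \<nu> (\<lambda>\<beta>. \<beta> a ^ n) (L (a ^ n))"
proof -
  have "has_bochner_integral \<nu> (\<lambda>\<beta>. \<beta> (a ^ n)) (L (a ^ n))"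
    using represented by (simp add: represented_by_def)
  then show ?thesis
    by (subst has_bochner_integral_cong[OF refl _ refl, of \<nu> _ "\<lambda>\<beta>. \<beta> (a ^ n)"])
       (auto simp: space_eq character_power)
qed

lemma integrable_power: "integrable \<nu> (\<lambda>\<beta>. \<beta> a ^ n)"
  and integral_power: "(\<integral>\<beta>. \<beta> a ^ n \<partial>\<nu>) = L (a ^ n)"
  using has_bochner_integral_power[of a n] by (auto simp: has_bochner_integral_iff)

sublocale prob_space \<nu>
proof
  have "has_bochner_integral \<nu> (\<lambda>_. 1 :: real) 1"
    using has_bochner_integral_power[of 1 0] by (simp add: L_one)
  \<comment> \<open>The nonnegative integral determines \<open>emeasure\<close> itself. The
    real-valued \<open>measure\<close> would not do here, since it is 0 for infinite mass and
    finiteness is not known yet.\<close>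
  then have "integral\<^sup>N \<nu> (\<lambda>_. ennreal 1) = ennreal 1"
    using nn_integral_eq_integral[of \<nu> "\<lambda>_. 1 :: real"]
    by (simp add: has_bochner_integral_iff del: integral_const)
  then show "emeasure \<nu> (space \<nu>) = 1" by simp
qed

lemma AE_support: "AE \<beta> in \<nu>. \<beta> \<in> K"
proof (rule AE_I)
  show "{\<beta> \<in> space \<nu>. \<beta> \<notin> K} \<subseteq> character_space - K" by (auto simp: space_eq)
  show "emeasure \<nu> (character_space - K) = 0" using support by (simp add: is_support_def)
  show "character_space - K \<in> sets \<nu>"
    using support by (intro openin_sets) (simp add: is_support_def closedin_def)
qed

text \<open>If \<open>U\<close> were null, its complement would be a closed set of full mass, and
  the support, being the smallest such set, would miss \<alpha>.\<close>

lemma measure_open_pos: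
  assumes "openin character_topology U" and "\<alpha> \<in> K" and "\<alpha> \<in> U"
  shows "0 < measure \<nu> U"
proof -
  have U: "U \<subseteq> character_space" using openin_subset[OF assms(1)] by simp
  have "measure \<nu> U \<noteq> 0"
  proof
    assume "measure \<nu> U = 0"
    then have "emeasure \<nu> U = 0" by (simp add: emeasure_eq_measure)
    moreover have "character_space - (character_space - U) = U" using U by auto
    moreover have "closedin character_topology (character_space - U)"
      using assms(1) closedin_diff[OF closedin_topspace assms(1)] by simp
    ultimately have "K \<subseteq> character_space - U" using support by (simp add: is_support_def)
    then show False using assms by auto
  qed
  then show ?thesis by (simp add: zero_less_measure_iff)
qed

lemma singleton_sets: "\<alpha> \<in> character_space \<Longrightarrow> {\<alpha>} \<in> sets \<nu>"
  by (intro closedin_sets compactin_imp_closedin[OF Hausdorff_space_character_topology]) simp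

section \<open>Two-sided bounds for even moments\<close>

text \<open>This is Markov's inequality: evenness of \<open>m\<close> gives the bound by
  \<open>t ^ m\<close> on \<open>B\<close> and nonnegativity of the integrand elsewhere.\<close>

lemma even_moment_ge:
  assumes "B \<in> sets \<nu>" and "0 \<le> t" and "\<And>\<beta>. \<beta> \<in> B \<Longrightarrow> t \<le> \<bar>\<beta> a\<bar>" and "even m"
  shows "t ^ m * measure \<nu> B \<le> L (a ^ m)"
proof -
  have "(\<integral>\<beta>. indicator B \<beta> * t ^ m \<partial>\<nu>) \<le> (\<integral>\<beta>. \<beta> a ^ m \<partial>\<nu>)"
  proof (rule integral_mono)
    show "integrable \<nu> (\<lambda>\<beta>. indicator B \<beta> * t ^ m)" using assms(1)
      by (intro integrable_mult_left integrable_real_indicator) (auto simp: emeasure_eq_measure)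
    show "integrable \<nu> (\<lambda>\<beta>. \<beta> a ^ m)" by (rule integrable_power)
    show "indicator B \<beta> * t ^ m \<le> \<beta> a ^ m" for \<beta>
    proof (cases "\<beta> \<in> B")
      case True
      then have "t ^ m \<le> \<bar>\<beta> a\<bar> ^ m" using assms by (intro power_mono) auto
      then show ?thesis using True \<open>even m\<close> by (simp add: power_even_abs)
    qed (use \<open>even m\<close> in \<open>simp add: zero_le_even_power\<close>)
  qed
  moreover have "(\<integral>\<beta>. \<beta> a ^ m \<partial>\<nu>) = L (a ^ m)" by (rule integral_power)
  moreover have "(\<integral>\<beta>. indicator B \<beta> * t ^ m \<partial>\<nu>) = t ^ m * measure \<nu> B"
    using sets.Int_space_eq2[OF assms(1)] by simp
  ultimately show ?thesis by metis
qed

text \<open>Almost every point lies in \<open>K\<close>, where the integrand is at most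
  \<open>s ^ m\<close> on \<open>B\<close> and at most \<open>M ^ m\<close> off \<open>B\<close>. It
  is used with \<open>B\<close> the whole space to bound \<open>p_sup\<close>, and with
  \<open>B\<close> a compact set on which a peaking element is small.\<close>

lemma even_moment_le:
  assumes "B \<in> sets \<nu>" and "0 \<le> s" "\<And>\<beta>. \<beta> \<in> K \<inter> B \<Longrightarrow> \<bar>\<beta> a\<bar> \<le> s"
    and "0 \<le> M" "\<And>\<beta>. \<beta> \<in> K \<Longrightarrow> \<bar>\<beta> a\<bar> \<le> M" and "even m"
  shows "L (a ^ m) \<le> s ^ m + M ^ m * (1 - measure \<nu> B)"
proof -
  have "(\<integral>\<beta>. \<beta> a ^ m \<partial>\<nu>) \<le> (\<integral>\<beta>. s ^ m + indicator (space \<nu> - B) \<beta> * M ^ m \<partial>\<nu>)"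
  proof (rule integral_mono_AE)
    show "integrable \<nu> (\<lambda>\<beta>. s ^ m + indicator (space \<nu> - B) \<beta> * M ^ m)"
      using assms(1) by (intro Bochner_Integration.integrable_add integrable_mult_left
          integrable_real_indicator)
        (auto simp: emeasure_eq_measure)
    show "integrable \<nu> (\<lambda>\<beta>. \<beta> a ^ m)" by (rule integrable_power)
    show "AE \<beta> in \<nu>. \<beta> a ^ m \<le> s ^ m + indicator (space \<nu> - B) \<beta> * M ^ m"
      using AE_support
    proof eventually_elim
      case (elim \<beta>)
      show ?case
      proof (cases "\<beta> \<in> B")
        case True
        then have "\<bar>\<beta> a\<bar> ^ m \<le> s ^ m" using assms elim by (intro power_mono) auto
        then show ?thesis using True \<open>even m\<close> by (simp add: power_even_abs)
      next
        case False
        have "\<bar>\<beta> a\<bar> ^ m \<le> M ^ m" using assms elim by (intro power_mono) auto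
        moreover have "0 \<le> s ^ m" using assms(2) by simp
        ultimately show ?thesis
          using False elim support_subset \<open>even m\<close> by (auto simp: power_even_abs space_eq)
      qed
    qed
  qed
  moreover have "(\<integral>\<beta>. \<beta> a ^ m \<partial>\<nu>) = L (a ^ m)" by (rule integral_power)
  moreover have "(\<integral>\<beta>. s ^ m + indicator (space \<nu> - B) \<beta> * M ^ m \<partial>\<nu>)
      = s ^ m + M ^ m * (1 - measure \<nu> B)"
    using assms(1) by (subst Bochner_Integration.integral_add)
      (auto simp: prob_space prob_compl emeasure_eq_measure
        intro!: integrable_mult_left integrable_real_indicator)
  ultimately show ?thesis by simp
qed

lemma root_even_moment_le:
  assumes "0 \<le> M" "\<And>\<beta>. \<beta> \<in> K \<Longrightarrow> \<bar>\<beta> a\<bar> \<le> M" and "1 \<le> n"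
  shows "root (2 * n) (L (a ^ (2 * n))) \<le> M"
proof -
  have "L (a ^ (2 * n)) \<le> M ^ (2 * n)"
    using even_moment_le[of "space \<nu>" M a M "2 * n"] assms by (simp add: prob_space)
  then have "root (2 * n) (L (a ^ (2 * n))) \<le> root (2 * n) (M ^ (2 * n))"
    using assms(3) by (intro real_root_le_mono) auto
  also have "\<dots> = M" using assms by (intro real_root_power_cancel) auto
  finally show ?thesis .
qed

section \<open>The supremum \<open>p_sup\<close> as the maximum over the support\<close>

lemma p_sup_le:
  assumes "0 \<le> M" and "\<And>\<beta>. \<beta> \<in> K \<Longrightarrow> \<bar>\<beta> a\<bar> \<le> M"
  shows "p_sup L a \<le> M"
  unfolding p_sup_def by (rule cSUP_least) (use root_even_moment_le assms in auto)

text \<open>For t below \<bar>\<alpha> a\<bar> the characters with absolute value above t at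
  \<open>a\<close> form an open neighbourhood of \<alpha>, which has positive mass. Markov's
  inequality bounds the roots of the moments below by t times roots of this mass, and these tend to
  1.\<close>

lemma p_sup_ge:
  assumes "\<alpha> \<in> K"
  shows "\<bar>\<alpha> a\<bar> \<le> p_sup L a"
proof -
  have "bounded ((\<lambda>\<beta>. \<bar>\<beta> a\<bar>) ` K)"
    by (rule compact_imp_bounded[OF compact_eval_image[OF compact_support]])
  then obtain M where M: "0 < M" "\<And>\<beta>. \<beta> \<in> K \<Longrightarrow> \<bar>\<beta> a\<bar> \<le> M"
    by (auto simp: bounded_pos)
  \<comment> \<open>A real supremum dominates its members only if they are bounded above;
    compactness of \<open>K\<close> supplies the bound \<open>M\<close>.\<close>
  have root_le: "root (2 * n) (L (a ^ (2 * n))) \<le> p_sup L a" if "1 \<le> n" for n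
    unfolding p_sup_def
  proof (rule cSUP_upper)
    show "bdd_above ((\<lambda>n. root (2 * n) (L (a ^ (2 * n)))) ` {1..})"
      using M by (intro bdd_aboveI2[of _ _ M] root_even_moment_le) auto
  qed (use that in simp)
  have below: "t \<le> p_sup L a" if t: "0 \<le> t" "t < \<bar>\<alpha> a\<bar>" for t
  proof -
    define U where "U = {\<beta> \<in> character_space. \<beta> a \<in> {x. t < \<bar>x\<bar>}}"
    have U: "openin character_topology U"
      unfolding U_def by (intro openin_character_topology_eval open_Collect_less continuous_intros)
    have pos: "0 < measure \<nu> U"
      using assms support_subset t by (intro measure_open_pos[OF U assms]) (auto simp: U_def)
    have "t * root (2 * n) (measure \<nu> U) \<le> p_sup L a" if n: "1 \<le> n" for n
    proof -
      have "t ^ (2 * n) * measure \<nu> U \<le> L (a ^ (2 * n))"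
        by (rule even_moment_ge) (use t openin_sets[OF U] in \<open>auto simp: U_def\<close>)
      then have "root (2 * n) (t ^ (2 * n) * measure \<nu> U) \<le> root (2 * n) (L (a ^ (2 * n)))"
        using n by (intro real_root_le_mono) auto
      moreover have "root (2 * n) (t ^ (2 * n) * measure \<nu> U) = t * root (2 * n) (measure \<nu> U)"
        using n t by (simp add: real_root_mult real_root_power_cancel)
      ultimately show ?thesis using root_le[OF n] by simp
    qed
    moreover have "(\<lambda>n. t * root (2 * n) (measure \<nu> U)) \<longlonglongrightarrow> t * 1"
    proof (intro tendsto_mult tendsto_const)
      have "strict_mono (\<lambda>n::nat. 2 * n)" by (simp add: strict_mono_def)
      from LIMSEQ_subseq_LIMSEQ[OF LIMSEQ_root_const[OF pos] this]
      show "(\<lambda>n. root (2 * n) (measure \<nu> U)) \<longlonglongrightarrow> 1" by (simp only: o_def)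
    qed
    ultimately have "t * 1 \<le> p_sup L a" by (intro LIMSEQ_le_const2) blast+
    then show ?thesis by simp
  qed
  show ?thesis
  \<comment> \<open>If \<open>\<alpha> a = 0\<close>, no \<open>t\<close> satisfies the premises of
    \<open>below\<close>. The term for \<open>n = 1\<close> then suffices: \<open>L (a ^ 2)\<close>
    is nonnegative by the lower moment bound with empty \<open>B\<close>.\<close>
  proof (cases "\<alpha> a = 0")
    case True
    have "0 \<le> root 2 (L (a ^ 2))"
      using even_moment_ge[of "{}" 0 a 2] by simp
    then have "0 \<le> root (2 * 1) (L (a ^ (2 * 1)))" by simp
    also have "\<dots> \<le> p_sup L a" by (rule root_le) simp
    finally show ?thesis using True by simp
  next
    case False
    then have "0 < \<bar>\<alpha> a\<bar>" by simp
    then show ?thesis by (rule dense_le_bounded) (simp add: below)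
  qed
qed

section \<open>The mass of a single character\<close>

text \<open>Inner regularity is applied to the complement of {\<alpha>}, whose mass is one minus
  that of {\<alpha>}; at most \<epsilon> is lost.\<close>

lemma exists_compact_avoiding_point:
  assumes "\<alpha> \<in> character_space" and "0 < \<epsilon>"
  obtains C where "compactin character_topology C" "C \<in> sets \<nu>" "\<alpha> \<notin> C"
    "1 - measure \<nu> C \<le> measure \<nu> {\<alpha>} + \<epsilon>"
proof -
  let ?B = "space \<nu> - {\<alpha>}"
  have B: "?B \<in> sets \<nu>" using singleton_sets[OF assms(1)] by auto
  have mB: "measure \<nu> ?B = 1 - measure \<nu> {\<alpha>}" by (rule prob_compl[OF singleton_sets[OF assms(1)]])
  show thesis
  \<comment> \<open>For a complement of mass at most \<epsilon> the empty set works. The case is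
    separate because \<open>ennreal\<close> sends negative reals to 0, so the strict inequality used
    in the other case could fail.\<close>
  proof (cases "measure \<nu> ?B \<le> \<epsilon>")
    case True
    then show thesis using that[of "{}"] mB by simp
  next
    case False
    have "emeasure \<nu> ?B = (SUP C\<in>{C. compactin character_topology C \<and> C \<subseteq> ?B}. emeasure \<nu> C)"
      using radon B by (simp add: radon_measure_def)
    moreover have "ennreal (measure \<nu> ?B - \<epsilon>) < emeasure \<nu> ?B"
      using False assms(2) by (simp add: emeasure_eq_measure ennreal_less_iff)
    ultimately obtain C where C: "compactin character_topology C" "C \<subseteq> ?B"
      "ennreal (measure \<nu> ?B - \<epsilon>) < emeasure \<nu> C"
      by (auto simp: less_SUP_iff)
    have "measure \<nu> ?B - \<epsilon> < measure \<nu> C"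
      using C(3) False by (simp add: emeasure_eq_measure ennreal_less_iff)
    moreover have "C \<in> sets \<nu>"
      by (rule closedin_sets[OF compactin_imp_closedin[OF Hausdorff_space_character_topology C(1)]])
    ultimately show thesis using that[of C] C mB by auto
  qed
qed

text \<open>On the peak set \<open>p_sup L a\<close> is at most \<bar>\<alpha> a\<bar>, and Markov's
  inequality for the set {\<alpha>} gives the rest. The exponent \<open>2 ^ d\<close> is even
  because \<open>1 \<le> d\<close>.\<close>

lemma root_mass_mult_p_sup_le:
  assumes "\<alpha> \<in> K" and "a \<in> peak_set K \<alpha>" and "1 \<le> d"
  shows "root (2 ^ d) (measure \<nu> {\<alpha>}) * p_sup L a \<le> p_pow L d a"
proof -
  have "p_sup L a \<le> \<bar>\<alpha> a\<bar>"
    using assms mem_peak_set_iff[OF compact_support] by (intro p_sup_le) auto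
  then have "root (2 ^ d) (measure \<nu> {\<alpha>}) * p_sup L a \<le> root (2 ^ d) (measure \<nu> {\<alpha>}) * \<bar>\<alpha> a\<bar>"
    by (intro mult_left_mono) auto
  also have "\<dots> = root (2 ^ d) (\<bar>\<alpha> a\<bar> ^ 2 ^ d * measure \<nu> {\<alpha>})"
    by (simp add: real_root_mult real_root_power_cancel)
  also have "\<dots> \<le> p_pow L d a"
    unfolding p_pow_def using assms support_subset
    by (intro real_root_le_mono even_moment_ge singleton_sets) auto
  finally show ?thesis .
qed

text \<open>Testing the hypothesis with an element that peaks at \<alpha> bounds \<open>l\<close> by
  a moment. That moment sees little more than the mass of {\<alpha>}, because the element is small
  on a compact set carrying almost all the remaining mass.\<close>

lemma le_mass:
  assumes "\<alpha> \<in> K" and "1 \<le> d" and "0 \<le> l"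
    and l: "\<And>a. a \<in> peak_set K \<alpha> \<Longrightarrow> root (2 ^ d) l * p_sup L a \<le> p_pow L d a"
  shows "l \<le> measure \<nu> {\<alpha>}"
proof (rule field_le_epsilon)
  fix e :: real assume "0 < e"
  \<comment> \<open>The error \<epsilon> enters twice, through the size of \<open>a\<close> on
    \<open>C\<close> and through the mass missed by \<open>C\<close>, hence \<open>e / 2\<close>.
    The cap 1 ensures that powers of \<epsilon> do not exceed \<epsilon>.\<close>
  define \<epsilon> where "\<epsilon> = min 1 (e / 2)"
  have \<epsilon>: "0 < \<epsilon>" "\<epsilon> \<le> 1" "\<epsilon> \<le> e / 2" using \<open>0 < e\<close> by (auto simp: \<epsilon>_def)
  obtain C where C: "compactin character_topology C" "C \<in> sets \<nu>" "\<alpha> \<notin> C"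
    "1 - measure \<nu> C \<le> measure \<nu> {\<alpha>} + \<epsilon>"
    using exists_compact_avoiding_point[of \<alpha> \<epsilon>] assms(1) support_subset \<epsilon>(1) by blast
  obtain a where a: "\<alpha> a = 1" "\<And>\<beta>. \<beta> \<in> K \<Longrightarrow> \<bar>\<beta> a\<bar> \<le> 1" "\<And>\<beta>. \<beta> \<in> K \<inter> C \<Longrightarrow> \<bar>\<beta> a\<bar> < \<epsilon>"
    using exists_peaking_element[OF compact_support C(1) assms(1) C(3) \<epsilon>(1)] by blast
  have "a \<in> peak_set K \<alpha>" using a mem_peak_set_iff[OF compact_support assms(1)] by simp
  \<comment> \<open>The normalisation \<open>\<alpha> a = 1\<close> forces \<open>p_sup L a\<close>
    to be at least 1, so this factor can be inserted.\<close>
  have "root (2 ^ d) l \<le> root (2 ^ d) l * p_sup L a"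
    using p_sup_ge[OF assms(1), of a] a(1) assms(3) by (simp add: mult_le_cancel_left1)
  also have "\<dots> \<le> root (2 ^ d) (L (a ^ 2 ^ d))"
    using l[OF \<open>a \<in> peak_set K \<alpha>\<close>] by (simp add: p_pow_def)
  finally have "l \<le> L (a ^ 2 ^ d)" by simp
  also have "\<dots> \<le> \<epsilon> ^ 2 ^ d + 1 ^ 2 ^ d * (1 - measure \<nu> C)"
  proof (rule even_moment_le)
    show "\<bar>\<beta> a\<bar> \<le> \<epsilon>" if "\<beta> \<in> K \<inter> C" for \<beta> using a(3)[OF that] by simp
  qed (use C(2) \<epsilon>(1) a(2) assms(2) in simp_all)
  also have "\<dots> \<le> \<epsilon> ^ 1 + (measure \<nu> {\<alpha>} + \<epsilon>)"
  proof (intro add_mono)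
    show "\<epsilon> ^ 2 ^ d \<le> \<epsilon> ^ 1" using \<epsilon> by (intro power_decreasing) auto
  qed (use C(4) in simp)
  also have "\<dots> \<le> measure \<nu> {\<alpha>} + e" using \<epsilon>(3) by simp
  finally show "l \<le> measure \<nu> {\<alpha>} + e" .
qed

end

theorem theorem3p12:
  fixes L :: "'a::{real_algebra_1,comm_ring_1} \<Rightarrow> real"
    and \<nu> :: "('a \<Rightarrow> real) measure"
    and K :: "('a \<Rightarrow> real) set"
    and d :: nat
  assumes "(character_space :: ('a \<Rightarrow> real) set) \<noteq> {}"
    and "linear L"
    and "L 1 = 1"
    and "radon_measure character_topology \<nu>"
    and "represented_by L \<nu>"
    and "is_support character_topology \<nu> K"
    and "compactin character_topology K"
    and "d \<ge> 1"
  shows "\<forall>\<alpha>\<in>K. is_maximum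
           {l \<in> {0..1}. \<forall>a\<in>peak_set K \<alpha>. root (2 ^ d) l * p_sup L a \<le> p_pow L d a}
           (measure \<nu> {\<alpha>})"
proof -
  interpret represented_functional L \<nu> K
    by unfold_locales (use assms in auto)
  show ?thesis
    unfolding is_maximum_def
  proof (intro ballI conjI)
    fix \<alpha> assume "\<alpha> \<in> K"
    then show "measure \<nu> {\<alpha>} \<in>
        {l \<in> {0..1}. \<forall>a\<in>peak_set K \<alpha>. root (2 ^ d) l * p_sup L a \<le> p_pow L d a}"
      using root_mass_mult_p_sup_le assms(8) by simp
    fix l assume "l \<in> {l \<in> {0..1}. \<forall>a\<in>peak_set K \<alpha>. root (2 ^ d) l * p_sup L a \<le> p_pow L d a}"
    then show "l \<le> measure \<nu> {\<alpha>}"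
      using le_mass[OF \<open>\<alpha> \<in> K\<close> assms(8)] by simp
  qed
qed

end
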